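(* (P4) For the system $$\frac{dx}{dt}=x(x^2+y^2-1)(x^2+y^2-9)-y(x^2+y^2-2x-8),$$ $$\frac{dy}{dt}=y(x^2+y^2-1)(x^2+y^2-9)+x(x^2+y^2-2x-8),$$ every point at infinity is a fixed point; in particular the system has no limit cycle at infinity. (P5) For every real $c$, for the system $$\frac{dx}{dt}=x(2x^2+2y^2+1)\bigl((x^2+y^2)^2+x^2-y^2-c\bigr)-y(2x^2+2y^2-1),$$ $$\frac{dy}{dt}=y(2x^2+2y^2-1)\bigl((x^2+y^2)^2+x^2-y^2-c\bigr)+x(2x^2+2y^2+1),$$ every point at infinity is a fixed point; in particular the system has no limit cycle at infinity.
   Context: Behavior at infinity (Poincaré sphere): the phase plane is tangent to a sphere and is mapped to it by central projection from the center, antipodal points being identified; points at infinity of the plane correspond to points of the equator. A polynomial system of degree $m$ (the maximum of the degrees of the two right-hand sides) is extended to the equator with the standard (Poincaré compactification) time rescaling, under which the equator is invariant, i.e. consists of trajectories and fixed points. Concretely, near the equator use coordinates $(s,\theta)$ with $s=1/r\ge 0$, so $x=\cos\theta/s$, $y=\sin\theta/s$, and new time $\tau$ with $dt=s^{m-1}d\tau$; the resulting vector field in $(s,\theta)$ extends smoothly to $s=0$ (the equator) with $ds/d\tau=0$ there. A fixed point at infinity is a zero of this extended field on $s=0$. There is a cycle at infinity if there are no fixed points at infinity (so that the equator is a closed orbit); it is a limit cycle at infinity if nearby trajectories approach it or recede from it. *)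

theory Defs
  imports "HOL-Analysis.Analysis" "HOL-Computational_Algebra.Polynomial"
begin

section \<open>Polynomials in two variables\<close>

text \<open>A polynomial in \<open>x, y\<close> is a polynomial in \<open>y\<close> whose coefficients are polynomials in \<open>x\<close>.\<close>

type_synonym poly_xy = "real poly poly"

definition X :: poly_xy where "X = [:[:0, 1:]:]"

definition Y :: poly_xy where "Y = [:0, 1:]"

definition const_xy :: "real \<Rightarrow> poly_xy" where "const_xy a = [:[:a:]:]"

definition eval_xy :: "poly_xy \<Rightarrow> real \<Rightarrow> real \<Rightarrow> real" where
  "eval_xy p x y = poly (poly p [:y:]) x"

text \<open>The total degree; the zero polynomial gets degree \<open>0\<close>.\<close>

definition total_degree :: "poly_xy \<Rightarrow> nat" where
  "total_degree p = Max (insert 0 {i + j | i j. coeff (coeff p j) i \<noteq> 0})"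

definition system_degree :: "poly_xy \<Rightarrow> poly_xy \<Rightarrow> nat" where
  "system_degree P Q = max (total_degree P) (total_degree Q)"

lemma eval_xy_X [simp]: "eval_xy X x y = x"
  and eval_xy_Y [simp]: "eval_xy Y x y = y"
  and eval_xy_const [simp]: "eval_xy (const_xy a) x y = a"
  and eval_xy_add [simp]: "eval_xy (p + q) x y = eval_xy p x y + eval_xy q x y"
  and eval_xy_diff [simp]: "eval_xy (p - q) x y = eval_xy p x y - eval_xy q x y"
  and eval_xy_mult [simp]: "eval_xy (p * q) x y = eval_xy p x y * eval_xy q x y"
  and eval_xy_power [simp]: "eval_xy (p ^ n) x y = eval_xy p x y ^ n"
  and eval_xy_one [simp]: "eval_xy 1 x y = 1"
  and eval_xy_numeral [simp]: "eval_xy (numeral k) x y = numeral k"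
  by (simp_all add: eval_xy_def X_def Y_def const_xy_def)

section \<open>The Poincare compactification near the equator\<close>

text \<open>
  The vector field of \<open>dx/dt = P(x,y), dy/dt = Q(x,y)\<close> in the coordinates \<open>z = (s, \<theta>)\<close>,
  \<open>x = cos \<theta> / s\<close>, \<open>y = sin \<theta> / s\<close>, \<open>s > 0\<close>. In the original time,
  \<open>ds/dt = - s\<^sup>2 (P cos \<theta> + Q sin \<theta>)\<close> and \<open>d\<theta>/dt = s (Q cos \<theta> - P sin \<theta>)\<close>;
  the factor \<open>s\<^bsup>m-1\<^esup>\<close> is the change of time \<open>dt = s\<^bsup>m-1\<^esup> d\<tau>\<close>. The exponent is an
  integer because \<open>m = 0\<close> is not excluded.
\<close>

definition chart_field :: "poly_xy \<Rightarrow> poly_xy \<Rightarrow> real \<times> real \<Rightarrow> real \<times> real" where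
  "chart_field P Q = (\<lambda>(s, \<theta>).
     let p = eval_xy P (cos \<theta> / s) (sin \<theta> / s);
         q = eval_xy Q (cos \<theta> / s) (sin \<theta> / s)
     in (s powi (int (system_degree P Q) - 1)) *\<^sub>R
          (- s\<^sup>2 * (p * cos \<theta> + q * sin \<theta>), s * (q * cos \<theta> - p * sin \<theta>)))"

text \<open>
  The extension of this field to the equator \<open>s = 0\<close> by continuity (jointly in \<open>s\<close> and \<open>\<theta>\<close>).
  It is meaningful for \<open>s \<ge> 0\<close> only; the limit always exists, see \<open>poincare_field_eq\<close> below.
\<close>

definition poincare_field :: "poly_xy \<Rightarrow> poly_xy \<Rightarrow> real \<times> real \<Rightarrow> real \<times> real" where
  "poincare_field P Q z =
     (if fst z > 0 then chart_field P Q z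
      else Lim (at z within ({0<..} \<times> UNIV)) (chart_field P Q))"

text \<open>Points at infinity are given by their angle; \<open>\<theta>\<close> and \<open>\<theta> + \<pi>\<close> are the same point.\<close>

definition fixed_point_at_infinity :: "poly_xy \<Rightarrow> poly_xy \<Rightarrow> real \<Rightarrow> bool" where
  "fixed_point_at_infinity P Q \<theta> \<longleftrightarrow> poincare_field P Q (0, \<theta>) = (0, 0)"

definition cycle_at_infinity :: "poly_xy \<Rightarrow> poly_xy \<Rightarrow> bool" where
  "cycle_at_infinity P Q \<longleftrightarrow> \<not> (\<exists>\<theta>. fixed_point_at_infinity P Q \<theta>)"

definition trajectory_on ::
    "real set \<Rightarrow> poly_xy \<Rightarrow> poly_xy \<Rightarrow> (real \<Rightarrow> real \<times> real) \<Rightarrow> bool" where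
  "trajectory_on T P Q z \<longleftrightarrow>
     (\<forall>\<tau>\<in>T. fst (z \<tau>) \<ge> 0 \<and>
        (z has_vector_derivative poincare_field P Q (z \<tau>)) (at \<tau> within T))"

text \<open>
  Because antipodal points are identified, the equator is approached from \<open>s > 0\<close> only.
  Receding from the equator means tending to it as \<open>\<tau> \<rightarrow> -\<infinity>\<close>.
\<close>

definition nearby_trajectories_approach :: "poly_xy \<Rightarrow> poly_xy \<Rightarrow> bool" where
  "nearby_trajectories_approach P Q \<longleftrightarrow>
     (\<exists>\<epsilon>>0. \<forall>s\<^sub>0 \<theta>\<^sub>0. 0 < s\<^sub>0 \<and> s\<^sub>0 < \<epsilon> \<longrightarrow>
        (\<exists>z. trajectory_on {0..} P Q z \<and> z 0 = (s\<^sub>0, \<theta>\<^sub>0) \<and>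
             ((\<lambda>\<tau>. fst (z \<tau>)) \<longlongrightarrow> 0) at_top))"

definition nearby_trajectories_recede :: "poly_xy \<Rightarrow> poly_xy \<Rightarrow> bool" where
  "nearby_trajectories_recede P Q \<longleftrightarrow>
     (\<exists>\<epsilon>>0. \<forall>s\<^sub>0 \<theta>\<^sub>0. 0 < s\<^sub>0 \<and> s\<^sub>0 < \<epsilon> \<longrightarrow>
        (\<exists>z. trajectory_on {..0} P Q z \<and> z 0 = (s\<^sub>0, \<theta>\<^sub>0) \<and>
             ((\<lambda>\<tau>. fst (z \<tau>)) \<longlongrightarrow> 0) at_bot))"

definition limit_cycle_at_infinity :: "poly_xy \<Rightarrow> poly_xy \<Rightarrow> bool" where
  "limit_cycle_at_infinity P Q \<longleftrightarrow>
     cycle_at_infinity P Q \<and>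
     (nearby_trajectories_approach P Q \<or> nearby_trajectories_recede P Q)"

section \<open>Existence of the extension\<close>

definition homogenized :: "nat \<Rightarrow> poly_xy \<Rightarrow> real \<times> real \<Rightarrow> real" where
  "homogenized m p = (\<lambda>(s, \<theta>). \<Sum>j\<le>degree p. \<Sum>i\<le>degree (coeff p j).
     coeff (coeff p j) i * cos \<theta> ^ i * sin \<theta> ^ j * s ^ (m - (i + j)))"

lemma finite_total_degrees: "finite {i + j | i j. coeff (coeff p j) i \<noteq> (0::real)}"
proof (rule finite_subset)
  show "{i + j | i j. coeff (coeff p j) i \<noteq> 0}
      \<subseteq> (\<Union>j\<le>degree p. \<Union>i\<le>degree (coeff p j). {i + j})"
  proof clarify
    fix i j assume *: "coeff (coeff p j) i \<noteq> 0"
    then have "coeff p j \<noteq> 0" by auto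
    then have "j \<le> degree p" by (rule le_degree)
    moreover from * have "i \<le> degree (coeff p j)" by (rule le_degree)
    ultimately show "i + j \<in> (\<Union>j\<le>degree p. \<Union>i\<le>degree (coeff p j). {i + j})" by blast
  qed
qed simp

lemma le_total_degree: "coeff (coeff p j) i \<noteq> 0 \<Longrightarrow> i + j \<le> total_degree p"
  unfolding total_degree_def
  by (rule Max_ge) (use finite_total_degrees in auto)

lemma eval_xy_altdef:
  "eval_xy p x y = (\<Sum>j\<le>degree p. \<Sum>i\<le>degree (coeff p j). coeff (coeff p j) i * x ^ i * y ^ j)"
  by (simp add: eval_xy_def poly_altdef[of p] poly_sum poly_power)
     (simp add: poly_altdef sum_distrib_right sum_distrib_left mult_ac)

lemma homogenized_eq:
  assumes "total_degree p \<le> m" "s > 0"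
  shows "homogenized m p (s, \<theta>) = s ^ m * eval_xy p (cos \<theta> / s) (sin \<theta> / s)"
proof -
  have "coeff (coeff p j) i * cos \<theta> ^ i * sin \<theta> ^ j * s ^ (m - (i + j)) =
        s ^ m * (coeff (coeff p j) i * (cos \<theta> / s) ^ i * (sin \<theta> / s) ^ j)" for i j
  proof (cases "coeff (coeff p j) i = 0")
    case False
    then have "i + j \<le> m" using le_total_degree[OF False] assms(1) by simp
    then have "s ^ m = s ^ (m - (i + j)) * (s ^ i * s ^ j)"
      by (simp flip: power_add)
    then show ?thesis using \<open>s > 0\<close> by (simp add: power_divide)
  qed simp
  then show ?thesis
    unfolding homogenized_def eval_xy_altdef sum_distrib_left prod.case
    by (intro sum.cong refl)
qed

lemma isCont_homogenized: "isCont (homogenized m p) z"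
  unfolding homogenized_def split_beta by (intro continuous_intros)

text \<open>In particular the first component vanishes on the equator.\<close>

lemma poincare_field_eq:
  fixes P Q :: poly_xy and s \<theta> :: real
  assumes "s \<ge> 0"
  defines "m \<equiv> system_degree P Q"
  defines "p \<equiv> homogenized m P" and "q \<equiv> homogenized m Q"
  shows "poincare_field P Q (s, \<theta>) =
    (- s * (p (s, \<theta>) * cos \<theta> + q (s, \<theta>) * sin \<theta>), q (s, \<theta>) * cos \<theta> - p (s, \<theta>) * sin \<theta>)"
proof -
  define F where "F = (\<lambda>z::real \<times> real.
    (- fst z * (p z * cos (snd z) + q z * sin (snd z)), q z * cos (snd z) - p z * sin (snd z)))"
  have chart: "chart_field P Q z = F z" if "fst z > 0" for z
  proof -
    obtain s \<theta> where z: "z = (s, \<theta>)" by (cases z)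
    with that have s: "s > 0" by simp
    have m: "total_degree P \<le> m" "total_degree Q \<le> m"
      by (auto simp: m_def system_degree_def)
    have powi: "s powi (int m - 1) = s ^ m / s"
      using s by (simp add: power_int_diff)
    show ?thesis
      using s unfolding z chart_field_def F_def p_def q_def
      by (simp add: homogenized_eq[OF m(1) s] homogenized_eq[OF m(2) s] Let_def powi
          flip: m_def) (simp add: field_simps power2_eq_square)
  qed
  have "isCont F z" for z
    unfolding F_def p_def q_def by (intro continuous_intros isCont_homogenized)
  then have "(F \<longlongrightarrow> F z) (at z within {0<..} \<times> UNIV)" for z
    by (meson continuous_at_imp_continuous_at_within continuous_within)
  moreover have "\<forall>\<^sub>F w in at z within {0<..} \<times> UNIV. F w = chart_field P Q w" for z
    unfolding eventually_at_filter by (rule always_eventually) (auto simp: chart)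
  ultimately have lim: "(chart_field P Q \<longlongrightarrow> F z) (at z within {0<..} \<times> UNIV)" for z
    by (rule Lim_transform_eventually)
  have "at (s, \<theta>) within ({0<..} \<times> UNIV) \<noteq> bot"
  proof -
    have "(\<lambda>n. (s + 1 / real (Suc n), \<theta>)) \<longlonglongrightarrow> (s + 0, \<theta>)"
      by (intro tendsto_intros LIMSEQ_Suc[OF lim_1_over_n])
    moreover have "(s + 1 / real (Suc n), \<theta>) \<in> {0<..} \<times> UNIV - {(s, \<theta>)}" for n
      using assms(1) by (auto intro: add_nonneg_pos)
    ultimately have "(s, \<theta>) islimpt ({0<..} \<times> UNIV)"
      unfolding islimpt_sequential by (auto intro!: exI[of _ "\<lambda>n. (s + 1 / real (Suc n), \<theta>)"])
    then show ?thesis by (simp add: trivial_limit_within)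
  qed
  then have "poincare_field P Q (s, \<theta>) = F (s, \<theta>)"
    using tendsto_Lim[OF _ lim] chart[of "(s, \<theta>)"] by (simp add: poincare_field_def)
  then show ?thesis by (simp add: F_def)
qed

end

theory Submission
  imports Defs
begin

text \<open>
  Since \<open>x = cos \<theta> / s\<close> and \<open>y = sin \<theta> / s\<close>, the angular component of the rescaled field is
  \<open>s\<^bsup>m+1\<^esup> R(x, y)\<close> with \<open>R = x Q - y P\<close> and \<open>m\<close> the degree of the system. In general \<open>R\<close> has degree
  \<open>m + 1\<close>, and the restriction of the angular component to the equator is the leading form of \<open>R\<close>
  on the unit circle. If \<open>R\<close> has degree at most \<open>m\<close>, then a factor \<open>s\<close> is left over and the
  whole equator consists of fixed points (\<open>fixed_point_at_infinity_if_low_degree\<close>).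

  In both systems the terms of highest degree form a radial field, a multiple of \<open>(x, y)\<close>, and so
  cancel in \<open>R\<close>. With \<open>\<rho> = x\<^sup>2 + y\<^sup>2\<close>, the first system has \<open>m = 5\<close> and
  \<open>R = \<rho> (\<rho> - 2 x - 8)\<close> of degree \<open>4\<close>. For the second one \<open>m = 7\<close> and \<open>R\<close> has degree \<open>6\<close>: the
  factors \<open>2 \<rho> + 1\<close> and \<open>2 \<rho> - 1\<close> of the radial terms differ by a constant only, so that what
  remains of these terms is \<open>-2 x y\<close> times the quartic factor.

  Thus an upper bound on the degree of \<open>R\<close> is needed, which follows from the behaviour of the total
  degree under ring operations, and a lower bound on \<open>m\<close>, which a single nonzero coefficient
  provides. A limit cycle at infinity requires an equator free of fixed points.
\<close>

section \<open>Bounds on the total degree\<close>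

lemma total_degree_le_iff:
  "total_degree p \<le> n \<longleftrightarrow> (\<forall>i j. coeff (coeff p j) i \<noteq> 0 \<longrightarrow> i + j \<le> n)"
  unfolding total_degree_def using finite_total_degrees[of p] by (subst Max_le_iff) auto

lemma total_degree_add_le:
  "total_degree p \<le> n \<Longrightarrow> total_degree q \<le> n \<Longrightarrow> total_degree (p + q) \<le> n"
  unfolding total_degree_le_iff by (metis add.right_neutral coeff_add)

lemma total_degree_diff_le:
  "total_degree p \<le> n \<Longrightarrow> total_degree q \<le> n \<Longrightarrow> total_degree (p - q) \<le> n"
  unfolding total_degree_le_iff by (metis diff_zero coeff_diff)

lemma total_degree_mult_le:
  assumes "total_degree p \<le> m" "total_degree q \<le> n"
  shows "total_degree (p * q) \<le> m + n"
  unfolding total_degree_le_iff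
proof (intro allI impI)
  fix i j assume "coeff (coeff (p * q) j) i \<noteq> 0"
  then have "(\<Sum>k\<le>j. \<Sum>l\<le>i. coeff (coeff p k) l * coeff (coeff q (j - k)) (i - l)) \<noteq> 0"
    by (simp add: coeff_mult coeff_sum)
  then obtain k l where kl: "k \<le> j" "l \<le> i"
      "coeff (coeff p k) l \<noteq> 0" "coeff (coeff q (j - k)) (i - l) \<noteq> 0"
    by (metis (no_types, lifting) atMost_iff mult_eq_0_iff sum.not_neutral_contains_not_neutral)
  then have "l + k \<le> m" "(i - l) + (j - k) \<le> n"
    using assms unfolding total_degree_le_iff by blast+
  with kl(1,2) show "i + j \<le> m + n" by linarith
qed

lemma total_degree_const_xy [simp]: "total_degree (const_xy a) = 0"
proof -
  have "total_degree (const_xy a) \<le> 0"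
    unfolding total_degree_le_iff const_xy_def
    by (auto simp: coeff_pCons split: nat.splits)
  then show ?thesis by simp
qed

lemma numeral_eq_const_xy: "numeral k = const_xy (numeral k)"
  by (simp add: const_xy_def numeral_poly)

lemma one_eq_const_xy: "1 = const_xy 1"
  by (simp add: const_xy_def one_pCons)

lemma total_degree_numeral [simp]: "total_degree (numeral k) = 0"
  by (simp only: numeral_eq_const_xy total_degree_const_xy)

lemma total_degree_one [simp]: "total_degree 1 = 0"
  by (simp only: one_eq_const_xy total_degree_const_xy)

lemma total_degree_power_le: "total_degree p \<le> m \<Longrightarrow> total_degree (p ^ k) \<le> k * m"
proof (induction k)
  case 0
  show ?case by simp
next
  case (Suc k)
  then show ?case using total_degree_mult_le[of p m "p ^ k" "k * m"] by simp
qed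

lemma total_degree_X_le: "total_degree X \<le> 1"
  by (auto simp: total_degree_le_iff X_def coeff_pCons split: nat.splits)

lemma total_degree_Y_le: "total_degree Y \<le> 1"
  by (auto simp: total_degree_le_iff Y_def coeff_pCons coeff_1 split: nat.splits)

text \<open>
  The coefficient of \<open>y\<^sup>0\<close> is the restriction of \<open>p\<close> to the line \<open>y = 0\<close>, so a lower bound on the total
  degree can be read off from a polynomial in \<open>x\<close> alone.
\<close>

lemma degree_restrict_le_total_degree: "degree (poly p 0) \<le> total_degree p"
proof (cases "poly p 0 = 0")
  case False
  then have "coeff (coeff p 0) (degree (poly p 0)) \<noteq> 0"
    by (simp add: poly_0_coeff_0)
  from le_total_degree[OF this] show ?thesis by simp
qed simp

section \<open>Equators consisting of fixed points\<close>

text \<open>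
  For \<open>s > 0\<close> the angular component equals \<open>s\<close> times the homogenization of \<open>R = x Q - y P\<close> in
  degree \<open>m\<close>, which exists because the degree of \<open>R\<close> is at most \<open>m\<close>. Both sides are continuous up
  to \<open>s = 0\<close>, where the right-hand one vanishes.
\<close>

lemma fixed_point_at_infinity_if_low_degree:
  assumes "total_degree (X * Q - Y * P) \<le> system_degree P Q"
  shows "fixed_point_at_infinity P Q \<theta>"
proof -
  define m where "m = system_degree P Q"
  define A where "A = (\<lambda>s. homogenized m Q (s, \<theta>) * cos \<theta> - homogenized m P (s, \<theta>) * sin \<theta>)"
  define B where "B = (\<lambda>s. s * homogenized m (X * Q - Y * P) (s, \<theta>))"
  have hom: "isCont (\<lambda>s. homogenized m p (s, \<theta>)) 0" for p
    by (rule isCont_o2[OF _ isCont_homogenized]) (intro continuous_intros)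
  have contA: "isCont A 0" and contB: "isCont B 0"
    unfolding A_def B_def by (intro continuous_intros hom)+
  have AB: "A s = B s" if s: "s > 0" for s
  proof -
    have "total_degree P \<le> m" "total_degree Q \<le> m" "total_degree (X * Q - Y * P) \<le> m"
      using assms by (auto simp: m_def system_degree_def)
    then show ?thesis
      using s unfolding A_def B_def by (simp add: homogenized_eq field_simps)
  qed
  have "(A \<longlongrightarrow> A 0) (at_right 0)" "(B \<longlongrightarrow> B 0) (at_right 0)"
    using contA contB by (auto simp: isCont_def intro: tendsto_within_subset)
  moreover have "\<forall>\<^sub>F s in at_right 0. A s = B s"
    using AB by (auto simp: eventually_at_filter)
  ultimately have "A 0 = B 0"
    by (metis (no_types) tendsto_cong tendsto_unique trivial_limit_at_right_real)
  then have "A 0 = 0" by (simp add: B_def)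
  then show ?thesis
    by (simp add: fixed_point_at_infinity_def poincare_field_eq A_def m_def)
qed

lemma no_limit_cycle_if_fixed_point:
  "fixed_point_at_infinity P Q \<theta> \<Longrightarrow> \<not> limit_cycle_at_infinity P Q"
  by (auto simp: limit_cycle_at_infinity_def cycle_at_infinity_def)

section \<open>The two systems\<close>

lemma total_degree_squares_le:
  "total_degree (X^2) \<le> 2" "total_degree (Y^2) \<le> 2" "total_degree (X^2 + Y^2) \<le> 2"
  using total_degree_power_le[OF total_degree_X_le, of 2]
    total_degree_power_le[OF total_degree_Y_le, of 2]
  by (simp_all add: total_degree_add_le)

lemma quintic_system_fixed_at_infinity:
  defines "P \<equiv> X * (X^2 + Y^2 - 1) * (X^2 + Y^2 - 9) - Y * (X^2 + Y^2 - 2 * X - 8)"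
  defines "Q \<equiv> Y * (X^2 + Y^2 - 1) * (X^2 + Y^2 - 9) + X * (X^2 + Y^2 - 2 * X - 8)"
  shows "fixed_point_at_infinity P Q \<theta>"
proof (rule fixed_point_at_infinity_if_low_degree)
  have "X * Q - Y * P = (X^2 + Y^2) * (X^2 + Y^2 - 2 * X - 8)"
    unfolding P_def Q_def by (simp add: algebra_simps power2_eq_square)
  moreover have "total_degree (2 * X) \<le> 2"
    using total_degree_mult_le[of 2 0 X 1] total_degree_X_le by simp
  then have "total_degree (X^2 + Y^2 - 2 * X - 8) \<le> 2"
    by (intro total_degree_diff_le total_degree_squares_le) auto
  ultimately have "total_degree (X * Q - Y * P) \<le> 2 + 2"
    by (simp only: total_degree_mult_le[OF total_degree_squares_le(3)])
  moreover have "5 \<le> total_degree P"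
  proof -
    have "poly P 0 = [:0, 9, 0, -10, 0, 1:]"
      unfolding P_def by (simp add: X_def Y_def numeral_poly one_pCons power2_eq_square)
    then show ?thesis using degree_restrict_le_total_degree[of P] by simp
  qed
  ultimately show "total_degree (X * Q - Y * P) \<le> system_degree P Q"
    by (simp add: system_degree_def)
qed

lemma septic_system_fixed_at_infinity:
  fixes c :: real
  defines "G \<equiv> (X^2 + Y^2)^2 + X^2 - Y^2 - const_xy c"
  defines "P \<equiv> X * (2 * X^2 + 2 * Y^2 + 1) * G - Y * (2 * X^2 + 2 * Y^2 - 1)"
  defines "Q \<equiv> Y * (2 * X^2 + 2 * Y^2 - 1) * G + X * (2 * X^2 + 2 * Y^2 + 1)"
  shows "fixed_point_at_infinity P Q \<theta>"
proof (rule fixed_point_at_infinity_if_low_degree)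
  have "X * Q - Y * P =
      (X^2 * (2 * X^2 + 2 * Y^2 + 1) + Y^2 * (2 * X^2 + 2 * Y^2 - 1)) - 2 * (X * Y) * G"
    unfolding P_def Q_def by (simp add: algebra_simps power2_eq_square)
  moreover have "total_degree (X^2 * (2 * X^2 + 2 * Y^2 + 1) + Y^2 * (2 * X^2 + 2 * Y^2 - 1)) \<le> 6"
  proof -
    have "total_degree (2 * X^2) \<le> 2" "total_degree (2 * Y^2) \<le> 2"
      using total_degree_mult_le[of 2 0 "X^2" 2] total_degree_mult_le[of 2 0 "Y^2" 2]
      by (simp_all add: total_degree_squares_le)
    then have "total_degree (2 * X^2 + 2 * Y^2 + 1) \<le> 2" "total_degree (2 * X^2 + 2 * Y^2 - 1) \<le> 2"
      by (auto intro: total_degree_add_le total_degree_diff_le)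
    from total_degree_mult_le[OF total_degree_squares_le(1) this(1)]
      total_degree_mult_le[OF total_degree_squares_le(2) this(2)]
    show ?thesis by (intro total_degree_add_le) simp_all
  qed
  moreover have "total_degree (2 * (X * Y) * G) \<le> 6"
  proof -
    have "total_degree ((X^2 + Y^2)^2) \<le> 4"
      using total_degree_power_le[OF total_degree_squares_le(3), of 2] by simp
    then have "total_degree G \<le> 4"
      unfolding G_def using total_degree_squares_le(1,2)
      by (intro total_degree_add_le total_degree_diff_le) auto
    moreover have "total_degree (2 * (X * Y)) \<le> 0 + (1 + 1)"
      by (intro total_degree_mult_le total_degree_X_le total_degree_Y_le) simp
    ultimately show ?thesis using total_degree_mult_le[of "2 * (X * Y)" 2 G 4] by simp
  qed
  ultimately have "total_degree (X * Q - Y * P) \<le> 6"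
    by (simp add: total_degree_diff_le)
  moreover have "7 \<le> total_degree P"
  proof -
    have "poly P 0 = [:0, -c, 0, 1 - 2 * c, 0, 3, 0, 2:]"
      unfolding P_def G_def
      by (simp add: X_def Y_def const_xy_def numeral_poly one_pCons power2_eq_square)
    then show ?thesis using degree_restrict_le_total_degree[of P] by simp
  qed
  ultimately show "total_degree (X * Q - Y * P) \<le> system_degree P Q"
    by (simp add: system_degree_def)
qed

theorem mainTheorem4:
  shows
    "(let P = X * (X^2 + Y^2 - 1) * (X^2 + Y^2 - 9) - Y * (X^2 + Y^2 - 2 * X - 8);
         Q = Y * (X^2 + Y^2 - 1) * (X^2 + Y^2 - 9) + X * (X^2 + Y^2 - 2 * X - 8)
     in (\<forall>\<theta>. fixed_point_at_infinity P Q \<theta>) \<and> \<not> limit_cycle_at_infinity P Q) \<and>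
     (\<forall>c::real.
       let P = X * (2 * X^2 + 2 * Y^2 + 1) * ((X^2 + Y^2)^2 + X^2 - Y^2 - const_xy c)
                 - Y * (2 * X^2 + 2 * Y^2 - 1);
           Q = Y * (2 * X^2 + 2 * Y^2 - 1) * ((X^2 + Y^2)^2 + X^2 - Y^2 - const_xy c)
                 + X * (2 * X^2 + 2 * Y^2 + 1)
       in (\<forall>\<theta>. fixed_point_at_infinity P Q \<theta>) \<and> \<not> limit_cycle_at_infinity P Q)"
  unfolding Let_def
  using quintic_system_fixed_at_infinity septic_system_fixed_at_infinity
    no_limit_cycle_if_fixed_point
  by blast

end
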